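(* Let $(X,d)$ be a uniformly discrete bounded geometry metric space, and let $\{\phi_i : X\to Y_i\}_{i=1}^n$ be a strongly embeddable family of maps. If the preimages $\{\phi_i^{-1}(w) : w\in Y_i,\ i=1,\ldots,n\}$, with the metrics restricted from $X$, are an equi-strongly embeddable family of metric spaces, then $X$ is strongly embeddable.
   Context: A metric space is uniformly discrete if distinct points are at distance at least some fixed $\delta>0$, and has bounded geometry if for every $r>0$ the cardinality of balls of radius $r$ is uniformly bounded. $B_S(x)=\{y : d(x,y)<S\}$ denotes the ball of radius $S$ centered at $x$ in the metric space under consideration. Strong embeddability: $(X,d)$ is strongly embeddable if for every $R,\epsilon>0$ there exists a map $\beta : X \to \ell^2(X)$, $x \mapsto \beta_x$, with $\|\beta_x\|=1$ for each $x\in X$, such that: (1) if $d(x,y)\le R$ then $\|\beta_x-\beta_y\|\le\epsilon$; (2) $\lim_{S\to\infty}\sup_{x\in X}\sum_{w\notin B_S(x)}|\beta_x(w)|^2=0$. Equi-strong embeddability: a family $(X_j)_{j\in\mathcal{I}}$ of metric spaces is equi-strongly embeddable if for every $R,\epsilon>0$ there is a family of maps $\xi^j : X_j\to\ell^2(X_j)$, $x\mapsto\xi^j_x$, with $\|\xi^j_x\|=1$ for all $x\in X_j$, such that: (1) for all $j\in\mathcal{I}$ and all $x,y\in X_j$ with $d(x,y)\le R$, $\|\xi^j_x-\xi^j_y\|\le\epsilon$; (2) $\lim_{S\to\infty}\sup_{j\in\mathcal{I}}\sup_{x\in X_j}\sum_{w\in X_j,\,w\notin B_S(x)}|\xi^j_x(w)|^2=0$.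 Strongly embeddable family of maps: for a finite family of sets $Y_1,\ldots,Y_n$, let $\mathcal{Y}=\bigsqcup_{i=1}^n Y_i$ be the disjoint union (each $Y_i$ regarded as a subset of $\mathcal{Y}$). A family of set maps $\{\phi_i : X\to Y_i\}_{i=1}^n$ is a strongly embeddable family of maps if for every $R,\epsilon>0$ there exists a map $\xi : X\to\ell^2(\mathcal{Y})$, $x\mapsto\xi_x$, with $\|\xi_x\|=1$ for all $x\in X$, such that: (1) for all $x,y\in X$ with $d(x,y)\le R$, $\|\xi_x-\xi_y\|\le\epsilon$; (2) $\lim_{S\to\infty}\sup_{x\in X}\sum_{w\notin\bigcup_i\phi_i(B_S(x))}|\xi_x(w)|^2=0$. *)

theory Defs
  imports "HOL-Analysis.Analysis"
begin

(* Elements of the complex Hilbert space l^2(A) are represented by functions on the whole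
   type that vanish off A. *)

definition ell2 :: "'a set \<Rightarrow> ('a \<Rightarrow> complex) set" where
  "ell2 A = {f. (\<forall>w. w \<notin> A \<longrightarrow> f w = 0) \<and> (\<lambda>w. (cmod (f w))\<^sup>2) summable_on A}"

definition ell2_norm :: "'a set \<Rightarrow> ('a \<Rightarrow> complex) \<Rightarrow> real" where
  "ell2_norm A f = sqrt (\<Sum>\<^sub>\<infinity>w\<in>A. (cmod (f w))\<^sup>2)"

definition uniformly_discrete :: "'a set \<Rightarrow> ('a \<Rightarrow> 'a \<Rightarrow> real) \<Rightarrow> bool" where
  "uniformly_discrete X d \<longleftrightarrow> (\<exists>\<delta>>0. \<forall>x\<in>X. \<forall>y\<in>X. x \<noteq> y \<longrightarrow> \<delta> \<le> d x y)"

definition bounded_geometry :: "'a set \<Rightarrow> ('a \<Rightarrow> 'a \<Rightarrow> real) \<Rightarrow> bool" where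
  "bounded_geometry X d \<longleftrightarrow>
     (\<forall>r>0. \<exists>N::nat. \<forall>x\<in>X. finite (Metric_space.mball X d x r) \<and>
                            card (Metric_space.mball X d x r) \<le> N)"

(* The suprema below are taken in ennreal, so that a supremum over the empty set is 0;
   the inner sums are real and converge because the functions lie in l^2. *)

definition strongly_embeddable :: "'a set \<Rightarrow> ('a \<Rightarrow> 'a \<Rightarrow> real) \<Rightarrow> bool" where
  "strongly_embeddable X d \<longleftrightarrow>
     (\<forall>R>0. \<forall>\<epsilon>>0. \<exists>\<beta>::'a \<Rightarrow> 'a \<Rightarrow> complex.
        (\<forall>x\<in>X. \<beta> x \<in> ell2 X \<and> ell2_norm X (\<beta> x) = 1) \<and>
        (\<forall>x\<in>X. \<forall>y\<in>X. d x y \<le> R \<longrightarrow> ell2_norm X (\<lambda>w. \<beta> x w - \<beta> y w) \<le> \<epsilon>) \<and>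
        ((\<lambda>S::real. SUP x\<in>X.
            ennreal (\<Sum>\<^sub>\<infinity>w\<in>X - Metric_space.mball X d x S. (cmod (\<beta> x w))\<^sup>2))
          \<longlongrightarrow> 0) at_top)"

definition equi_strongly_embeddable ::
    "'j set \<Rightarrow> ('j \<Rightarrow> 'a set) \<Rightarrow> ('j \<Rightarrow> 'a \<Rightarrow> 'a \<Rightarrow> real) \<Rightarrow> bool" where
  "equi_strongly_embeddable J X d \<longleftrightarrow>
     (\<forall>R>0. \<forall>\<epsilon>>0. \<exists>\<xi>::'j \<Rightarrow> 'a \<Rightarrow> 'a \<Rightarrow> complex.
        (\<forall>j\<in>J. \<forall>x\<in>X j. \<xi> j x \<in> ell2 (X j) \<and> ell2_norm (X j) (\<xi> j x) = 1) \<and>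
        (\<forall>j\<in>J. \<forall>x\<in>X j. \<forall>y\<in>X j. d j x y \<le> R \<longrightarrow>
            ell2_norm (X j) (\<lambda>w. \<xi> j x w - \<xi> j y w) \<le> \<epsilon>) \<and>
        ((\<lambda>S::real. SUP j\<in>J. SUP x\<in>X j.
            ennreal (\<Sum>\<^sub>\<infinity>w\<in>X j - Metric_space.mball (X j) (d j) x S. (cmod (\<xi> j x w))\<^sup>2))
          \<longlongrightarrow> 0) at_top)"

(* The disjoint union of Y 1, ..., Y n is the set of pairs (i, w) with w in Y i. *)

definition strongly_embeddable_maps ::
    "'a set \<Rightarrow> ('a \<Rightarrow> 'a \<Rightarrow> real) \<Rightarrow> nat \<Rightarrow> (nat \<Rightarrow> 'b set) \<Rightarrow> (nat \<Rightarrow> 'a \<Rightarrow> 'b) \<Rightarrow> bool" where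
  "strongly_embeddable_maps X d n Y \<phi> \<longleftrightarrow>
     (\<forall>R>0. \<forall>\<epsilon>>0. \<exists>\<xi>::'a \<Rightarrow> nat \<times> 'b \<Rightarrow> complex.
        (\<forall>x\<in>X. \<xi> x \<in> ell2 (Sigma {1..n} Y) \<and> ell2_norm (Sigma {1..n} Y) (\<xi> x) = 1) \<and>
        (\<forall>x\<in>X. \<forall>y\<in>X. d x y \<le> R \<longrightarrow>
            ell2_norm (Sigma {1..n} Y) (\<lambda>w. \<xi> x w - \<xi> y w) \<le> \<epsilon>) \<and>
        ((\<lambda>S::real. SUP x\<in>X.
            ennreal (\<Sum>\<^sub>\<infinity>w\<in>Sigma {1..n} Y -
                          (\<Union>i\<in>{1..n}. (\<lambda>y. (i, \<phi> i y)) ` Metric_space.mball X d x S).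
                        (cmod (\<xi> x w))\<^sup>2))
          \<longlongrightarrow> 0) at_top)"

end

theory Submission
  imports Defs
begin

text \<open>
  Squaring turns unit vectors of \<open>\<ell>\<^sup>2\<close> into probability densities: nearby vectors have densities that
  are close in \<open>\<ell>\<^sup>1\<close>, and conversely the square roots of densities close in \<open>\<ell>\<^sup>1\<close> are close in
  \<open>\<ell>\<^sup>2\<close>, because \<open>(\<surd>s - \<surd>t)\<^sup>2 \<le> \<bar>s - t\<bar>\<close>. On the level of densities the argument is a mixture.
  Truncate the density \<open>|\<xi>\<^sub>x|\<^sup>2\<close> on the disjoint union of the \<open>Y\<^sub>i\<close> to the image of the \<open>T\<close>-ball about \<open>x\<close>.
  Each point \<open>j\<close> of that image has a preimage \<open>p(x,j)\<close> within \<open>T\<close> of \<open>x\<close>; spread the mass at \<open>j\<close> over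
  the fibre of \<open>j\<close> according to the density \<open>|\<eta>\<^sup>j|\<^sup>2\<close> at \<open>p(x,j)\<close>. For \<open>d(x,y) \<le> R\<close> the points \<open>p(x,j)\<close>
  and \<open>p(y,j)\<close> are at distance at most \<open>R + 2T\<close>, so it suffices to choose \<open>\<eta>\<close> for that scale.

  All sums are nonnegative integrals over counting measures, where Tonelli's theorem holds over index sets
  of arbitrary cardinality and no summability has to be checked.
\<close>

section \<open>Sums over arbitrary index sets as integrals\<close>

lemma nn_integral_count_space_swap:
  fixes h :: "'i \<Rightarrow> 'a \<Rightarrow> ennreal"
  shows "(\<integral>\<^sup>+j. (\<integral>\<^sup>+z. h j z \<partial>count_space B) \<partial>count_space A) =
         (\<integral>\<^sup>+z. (\<integral>\<^sup>+j. h j z \<partial>count_space A) \<partial>count_space B)"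
proof -
  \<comment> \<open>Extension by zero moves both integrals to \<open>UNIV\<close>, where either
    order of iteration equals the integral over the counting measure of the product type. This
    covers uncountable sets, whose counting measures are not sigma-finite.\<close>
  define k where "k = (\<lambda>(j, z). h j z * indicator A j * indicator B z)"
  have "(\<integral>\<^sup>+j. (\<integral>\<^sup>+z. h j z \<partial>count_space B) \<partial>count_space A) =
        (\<integral>\<^sup>+j. (\<integral>\<^sup>+z. k (j, z) \<partial>count_space UNIV) \<partial>count_space UNIV)"
    by (auto simp: nn_integral_count_space_indicator k_def intro!: nn_integral_cong
        split: split_indicator)
  also have "\<dots> = (\<integral>\<^sup>+z. (\<integral>\<^sup>+j. k (j, z) \<partial>count_space UNIV) \<partial>count_space UNIV)"
    by (simp only: nn_integral_fst_count_space nn_integral_snd_count_space)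
  also have "\<dots> = (\<integral>\<^sup>+z. (\<integral>\<^sup>+j. h j z \<partial>count_space A) \<partial>count_space B)"
    by (auto simp: nn_integral_count_space_indicator k_def intro!: nn_integral_cong
        split: split_indicator)
  finally show ?thesis .
qed

lemma nn_integral_count_space_subset_le:
  assumes "A \<subseteq> B"
  shows "(\<integral>\<^sup>+w. f w \<partial>count_space A) \<le> (\<integral>\<^sup>+w. f w \<partial>count_space B)"
  using assms
  by (auto simp: nn_integral_count_space_indicator intro!: nn_integral_mono split: split_indicator)

lemma nn_integral_count_space_infsum:
  fixes f :: "'a \<Rightarrow> real"
  assumes "f summable_on A" "\<And>w. w \<in> A \<Longrightarrow> 0 \<le> f w"
  shows "(\<integral>\<^sup>+w. ennreal (f w) \<partial>count_space A) = ennreal (\<Sum>\<^sub>\<infinity>w\<in>A. f w)"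
proof -
  have "Infinite_Set_Sum.abs_summable_on f A"
    using assms(1) abs_summable_equivalent summable_on_iff_abs_summable_on_real by blast
  then show ?thesis
    using assms(2) by (simp add: nn_integral_conv_infsetsum infsetsum_infsum)
qed

text \<open>For real families, unconditional summability is absolute summability, which is
  integrability for the counting measure.\<close>

lemma summable_on_iff_nn_integral:
  fixes f :: "'a \<Rightarrow> real"
  assumes "\<And>w. w \<in> A \<Longrightarrow> 0 \<le> f w"
  shows "f summable_on A \<longleftrightarrow> (\<integral>\<^sup>+w. ennreal (f w) \<partial>count_space A) < \<infinity>"
proof -
  have "f summable_on A \<longleftrightarrow> Infinite_Set_Sum.abs_summable_on f A"
    using abs_summable_equivalent summable_on_iff_abs_summable_on_real by blast
  also have "\<dots> \<longleftrightarrow> (\<integral>\<^sup>+w. ennreal \<bar>f w\<bar> \<partial>count_space A) < \<infinity>"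
    by (simp add: Infinite_Set_Sum.abs_summable_on_def integrable_iff_bounded)
  also have "(\<integral>\<^sup>+w. ennreal \<bar>f w\<bar> \<partial>count_space A) = (\<integral>\<^sup>+w. ennreal (f w) \<partial>count_space A)"
    using assms by (intro nn_integral_cong) auto
  finally show ?thesis .
qed

section \<open>Square-summable functions and their densities\<close>

lemma ell2_iff_nn_integral:
  "f \<in> ell2 A \<longleftrightarrow> (\<forall>w. w \<notin> A \<longrightarrow> f w = 0) \<and>
     (\<integral>\<^sup>+w. ennreal ((cmod (f w))\<^sup>2) \<partial>count_space A) < \<infinity>"
  unfolding ell2_def by (simp add: summable_on_iff_nn_integral)

lemma nn_integral_ell2_subset:
  assumes "f \<in> ell2 A" "B \<subseteq> A"
  shows "(\<integral>\<^sup>+w. ennreal ((cmod (f w))\<^sup>2) \<partial>count_space B) = ennreal (\<Sum>\<^sub>\<infinity>w\<in>B. (cmod (f w))\<^sup>2)"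
proof (rule nn_integral_count_space_infsum)
  show "(\<lambda>w. (cmod (f w))\<^sup>2) summable_on B"
    using assms summable_on_subset_banach unfolding ell2_def by blast
qed simp

lemma nn_integral_ell2_norm:
  assumes "f \<in> ell2 A"
  shows "(\<integral>\<^sup>+w. ennreal ((cmod (f w))\<^sup>2) \<partial>count_space A) = ennreal ((ell2_norm A f)\<^sup>2)"
  unfolding nn_integral_ell2_subset[OF assms order_refl] ell2_norm_def
  by (simp add: infsum_nonneg)

lemma ell2_norm_nonneg: "0 \<le> ell2_norm A f"
  unfolding ell2_norm_def by (simp add: infsum_nonneg)

lemma ell2_diff:
  assumes "f \<in> ell2 A" "g \<in> ell2 A"
  shows "(\<lambda>w. f w - g w) \<in> ell2 A"
proof -
  have "(cmod (f w - g w))\<^sup>2 \<le> 2 * (cmod (f w))\<^sup>2 + 2 * (cmod (g w))\<^sup>2" for w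
  proof -
    have "(cmod (f w - g w))\<^sup>2 \<le> (cmod (f w) + cmod (g w))\<^sup>2"
      by (intro power_mono norm_triangle_ineq4) auto
    also have "\<dots> \<le> 2 * (cmod (f w))\<^sup>2 + 2 * (cmod (g w))\<^sup>2"
      using sum_squares_bound[of "cmod (f w)" "cmod (g w)"] by (simp add: power2_sum)
    finally show ?thesis .
  qed
  moreover have "(\<lambda>w. 2 * (cmod (f w))\<^sup>2 + 2 * (cmod (g w))\<^sup>2) summable_on A"
    using assms unfolding ell2_def by (intro summable_on_add summable_on_cmult_right) auto
  ultimately have "(\<lambda>w. (cmod (f w - g w))\<^sup>2) summable_on A"
    by (intro summable_on_comparison_test[where g = "\<lambda>w. (cmod (f w - g w))\<^sup>2"]) auto
  then show ?thesis
    using assms unfolding ell2_def by auto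
qed

text \<open>This is the passage from \<open>\<ell>\<^sup>2\<close> to \<open>\<ell>\<^sup>1\<close>.
  Integrating the pointwise bound, the squared distance contributes
  \<open>1 / \<epsilon> * \<epsilon>\<^sup>2\<close> and the unit mass of each vector contributes
  one further \<epsilon>.\<close>

lemma ell2_unit_square_diff:
  assumes f: "f \<in> ell2 A" "ell2_norm A f = 1" and g: "g \<in> ell2 A" "ell2_norm A g = 1"
    and "ell2_norm A (\<lambda>w. f w - g w) \<le> \<epsilon>" "0 < \<epsilon>"
  shows "(\<integral>\<^sup>+w. ennreal \<bar>(cmod (f w))\<^sup>2 - (cmod (g w))\<^sup>2\<bar> \<partial>count_space A) \<le> ennreal (3 * \<epsilon>)"
proof -
  \<comment> \<open>AM-GM with weight \<open>\<epsilon>\<close> replaces the Cauchy--Schwarz inequality.\<close>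
  have pt: "\<bar>(cmod u)\<^sup>2 - (cmod v)\<^sup>2\<bar> \<le> 1 / \<epsilon> * (cmod (u - v))\<^sup>2 + \<epsilon> * ((cmod u)\<^sup>2 + (cmod v)\<^sup>2)"
    for u v :: complex
  proof -
    define s t c where "s = cmod u" and "t = cmod v" and "c = cmod (u - v)"
    have "\<bar>s - t\<bar> \<le> c" and "0 \<le> s" "0 \<le> t"
      unfolding s_def t_def c_def by (auto simp: norm_triangle_ineq3)
    have "\<bar>s\<^sup>2 - t\<^sup>2\<bar> = \<bar>s - t\<bar> * (s + t)"
      using \<open>0 \<le> s\<close> \<open>0 \<le> t\<close> by (simp add: square_diff_square_factored power2_eq_square abs_mult)
    also have "\<dots> \<le> c * (s + t)"
      using \<open>\<bar>s - t\<bar> \<le> c\<close> \<open>0 \<le> s\<close> \<open>0 \<le> t\<close> by (intro mult_right_mono) auto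
    also have "\<dots> \<le> 1 / \<epsilon> * c\<^sup>2 + \<epsilon> * (s\<^sup>2 + t\<^sup>2)"
    proof -
      \<comment> \<open>Completing the square in \<open>c\<close> leaves
        \<open>\<epsilon>\<^sup>2 * (s + t)\<^sup>2 / 4\<close>. The second summand raises this to
        exactly \<open>\<epsilon>\<^sup>2 * (s\<^sup>2 + t\<^sup>2)\<close>, by the parallelogram
        identity.\<close>
      have "0 \<le> (c - \<epsilon> * (s + t) / 2)\<^sup>2 + \<epsilon>\<^sup>2 * ((s - t)\<^sup>2 + 2 * (s\<^sup>2 + t\<^sup>2)) / 4"
        by (intro add_nonneg_nonneg) auto
      also have "\<dots> = c\<^sup>2 - \<epsilon> * (c * (s + t)) + \<epsilon>\<^sup>2 * (s\<^sup>2 + t\<^sup>2)"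
        by (simp add: power2_eq_square field_simps)
      finally have "\<epsilon> * (c * (s + t)) \<le> \<epsilon> * (1 / \<epsilon> * c\<^sup>2 + \<epsilon> * (s\<^sup>2 + t\<^sup>2))"
        using \<open>0 < \<epsilon>\<close> by (simp add: power2_eq_square distrib_left)
      then show ?thesis using \<open>0 < \<epsilon>\<close> by simp
    qed
    finally show ?thesis unfolding s_def t_def c_def .
  qed
  have "(\<integral>\<^sup>+w. ennreal \<bar>(cmod (f w))\<^sup>2 - (cmod (g w))\<^sup>2\<bar> \<partial>count_space A) \<le>
      (\<integral>\<^sup>+w. ennreal (1 / \<epsilon>) * ennreal ((cmod (f w - g w))\<^sup>2) + ennreal \<epsilon> *
        (ennreal ((cmod (f w))\<^sup>2) + ennreal ((cmod (g w))\<^sup>2)) \<partial>count_space A)"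
    using \<open>0 < \<epsilon>\<close> pt
    by (intro nn_integral_mono) (simp add: ennreal_leI flip: ennreal_mult ennreal_plus)
  also have "\<dots> = ennreal (1 / \<epsilon>) * ennreal ((ell2_norm A (\<lambda>w. f w - g w))\<^sup>2) + ennreal \<epsilon> * (1 + 1)"
    using f g
    by (simp add: nn_integral_add nn_integral_cmult nn_integral_ell2_norm ell2_diff
        del: one_add_one)
  also have "\<dots> \<le> ennreal (1 / \<epsilon>) * ennreal (\<epsilon>\<^sup>2) + ennreal \<epsilon> * (1 + 1)"
    using assms(5) ell2_norm_nonneg
    by (intro add_right_mono mult_left_mono ennreal_leI power_mono) auto
  also have "\<dots> = ennreal (1 / \<epsilon> * \<epsilon>\<^sup>2 + \<epsilon> * 2)"
    using \<open>0 < \<epsilon>\<close> by (subst ennreal_plus) (auto simp: ennreal_mult simp del: times_divide_eq_left)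
  also have "1 / \<epsilon> * \<epsilon>\<^sup>2 + \<epsilon> * 2 = 3 * \<epsilon>"
    using \<open>0 < \<epsilon>\<close> by (simp add: power2_eq_square)
  finally show ?thesis .
qed

section \<open>From densities back to unit vectors\<close>

lemma sqrt_diff_square_le:
  assumes "0 \<le> s" "0 \<le> t"
  shows "(sqrt s - sqrt t)\<^sup>2 \<le> \<bar>s - t\<bar>"
proof -
  have "(sqrt s - sqrt t)\<^sup>2 = \<bar>sqrt s - sqrt t\<bar> * \<bar>sqrt s - sqrt t\<bar>"
    by (simp add: power2_eq_square)
  also have "\<dots> \<le> \<bar>sqrt s - sqrt t\<bar> * (sqrt s + sqrt t)"
    using assms real_sqrt_ge_zero[of s] real_sqrt_ge_zero[of t]
    by (intro mult_left_mono) (auto simp: abs_le_iff simp del: real_sqrt_ge_0_iff)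
  also have "\<dots> = \<bar>s - t\<bar>"
  proof -
    have "(sqrt s - sqrt t) * (sqrt s + sqrt t) = s - t"
      using assms by (simp add: algebra_simps)
    then have "\<bar>sqrt s - sqrt t\<bar> * \<bar>sqrt s + sqrt t\<bar> = \<bar>s - t\<bar>"
      by (simp flip: abs_mult)
    then show ?thesis using assms by simp
  qed
  finally show ?thesis .
qed

text \<open>Subtraction on \<open>ennreal\<close> is cut off at 0, so closeness of densities is
  carried as a pair of additive inequalities. Here the pair is turned into an absolute value of
  reals.\<close>

lemma enn2real_diff_le:
  assumes "s \<noteq> top" "t \<noteq> top" "s \<le> t + e" "t \<le> s + e"
  shows "ennreal \<bar>enn2real s - enn2real t\<bar> \<le> e"
  using assms
  by (cases s; cases t; cases e) (auto simp: abs_le_iff simp flip: ennreal_plus intro!: ennreal_leI)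

text \<open>Write \<open>a * q z - b * r z\<close> as \<open>(a - b) * q z + b * (q z - r z)\<close>
  and use that \<open>q\<close> has mass 1. If one weight vanishes, the integral is just
  \<open>\<bar>a - b\<bar>\<close>; the assumptions on \<open>q\<close> and \<open>r\<close> are
  therefore guarded by their weights, since a fibre density is meaningful only where its weight is
  nonzero.\<close>

lemma nn_integral_weighted_diff_le:
  fixes q r :: "'a \<Rightarrow> real"
  assumes "0 \<le> a" "0 \<le> b" "\<And>z. 0 \<le> q z" "\<And>z. 0 \<le> r z"
    and q: "a \<noteq> 0 \<Longrightarrow> (\<integral>\<^sup>+z. ennreal (q z) \<partial>count_space A) = 1"
    and r: "b \<noteq> 0 \<Longrightarrow> (\<integral>\<^sup>+z. ennreal (r z) \<partial>count_space A) = 1"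
    and qr: "a \<noteq> 0 \<Longrightarrow> b \<noteq> 0 \<Longrightarrow> (\<integral>\<^sup>+z. ennreal \<bar>q z - r z\<bar> \<partial>count_space A) \<le> e"
  shows "(\<integral>\<^sup>+z. ennreal \<bar>a * q z - b * r z\<bar> \<partial>count_space A) \<le> ennreal \<bar>a - b\<bar> + ennreal b * e"
proof -
  consider "a = 0" "b = 0" | "a = 0" "b \<noteq> 0" | "a \<noteq> 0" "b = 0" | "a \<noteq> 0" "b \<noteq> 0" by blast
  then show ?thesis
  proof cases
    case 4
    have "\<bar>a * q z - b * r z\<bar> \<le> \<bar>a - b\<bar> * q z + b * \<bar>q z - r z\<bar>" for z
    proof -
      have "a * q z - b * r z = (a - b) * q z + b * (q z - r z)"
        by (simp add: algebra_simps)
      also have "\<bar>\<dots>\<bar> \<le> \<bar>(a - b) * q z\<bar> + \<bar>b * (q z - r z)\<bar>"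
        by (rule abs_triangle_ineq)
      finally show ?thesis
        using assms by (simp add: abs_mult)
    qed
    then have "(\<integral>\<^sup>+z. ennreal \<bar>a * q z - b * r z\<bar> \<partial>count_space A) \<le>
        (\<integral>\<^sup>+z. ennreal \<bar>a - b\<bar> * ennreal (q z) + ennreal b * ennreal \<bar>q z - r z\<bar> \<partial>count_space A)"
      using assms by (intro nn_integral_mono) (simp add: ennreal_leI flip: ennreal_mult ennreal_plus)
    also have "\<dots> = ennreal \<bar>a - b\<bar> + ennreal b * (\<integral>\<^sup>+z. ennreal \<bar>q z - r z\<bar> \<partial>count_space A)"
      using 4 by (simp add: nn_integral_add nn_integral_cmult q)
    also have "\<dots> \<le> ennreal \<bar>a - b\<bar> + ennreal b * e"
      using 4 by (intro add_left_mono mult_left_mono qr) auto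
    finally show ?thesis .
  qed (use assms in \<open>auto simp: abs_mult ennreal_mult nn_integral_cmult\<close>)
qed

text \<open>The unit vectors are the square roots of the densities. The assumption is applied with
  tolerance \<open>\<epsilon>\<^sup>2\<close>, because the squared distance of the roots is at most
  the integral of the majorant \<open>e\<close>.\<close>

lemma strongly_embeddable_if_densities:
  fixes X :: "'a set"
  assumes "\<And>R \<epsilon>. 0 < R \<Longrightarrow> 0 < \<epsilon> \<Longrightarrow> \<exists>f :: 'a \<Rightarrow> 'a \<Rightarrow> ennreal.
      (\<forall>x\<in>X. (\<integral>\<^sup>+z. f x z \<partial>count_space X) = 1) \<and>
      (\<forall>x\<in>X. \<forall>y\<in>X. d x y \<le> R \<longrightarrow> (\<exists>e. (\<forall>z\<in>X. f x z \<le> f y z + e z \<and> f y z \<le> f x z + e z) \<and>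
          (\<integral>\<^sup>+z. e z \<partial>count_space X) \<le> ennreal \<epsilon>)) \<and>
      ((\<lambda>S. SUP x\<in>X. (\<integral>\<^sup>+z. f x z \<partial>count_space (X - Metric_space.mball X d x S))) \<longlongrightarrow> 0) at_top"
  shows "strongly_embeddable X d"
  unfolding strongly_embeddable_def
proof (intro allI impI)
  fix R \<epsilon> :: real
  assume "0 < R" "0 < \<epsilon>"
  then have "0 < \<epsilon>\<^sup>2" by simp
  then obtain f :: "'a \<Rightarrow> 'a \<Rightarrow> ennreal" where
    one: "\<And>x. x \<in> X \<Longrightarrow> (\<integral>\<^sup>+z. f x z \<partial>count_space X) = 1" and
    var: "\<And>x y. x \<in> X \<Longrightarrow> y \<in> X \<Longrightarrow> d x y \<le> R \<Longrightarrow>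
      \<exists>e. (\<forall>z\<in>X. f x z \<le> f y z + e z \<and> f y z \<le> f x z + e z) \<and>
          (\<integral>\<^sup>+z. e z \<partial>count_space X) \<le> ennreal (\<epsilon>\<^sup>2)" and
    tail: "((\<lambda>S. SUP x\<in>X. (\<integral>\<^sup>+z. f x z \<partial>count_space (X - Metric_space.mball X d x S))) \<longlongrightarrow> 0) at_top"
    using assms[OF \<open>0 < R\<close> \<open>0 < \<epsilon>\<^sup>2\<close>] by blast
  define \<beta> where "\<beta> x z = (if z \<in> X then complex_of_real (sqrt (enn2real (f x z))) else 0)" for x z
  \<comment> \<open>Each value is at most the total mass 1. Finiteness matters because
    \<open>enn2real\<close> sends \<open>top\<close> to 0.\<close>
  have fin: "f x z \<noteq> top" if "x \<in> X" "z \<in> X" for x z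
  proof -
    have "f x z \<le> 1" using nn_integral_ge_point[OF \<open>z \<in> X\<close>, of "f x"] one[OF \<open>x \<in> X\<close>] by simp
    then show ?thesis by (auto simp: top_unique)
  qed
  have sq: "ennreal ((cmod (\<beta> x z))\<^sup>2) = f x z" if "x \<in> X" "z \<in> X" for x z
    using that fin by (simp add: \<beta>_def less_top)
  have sum_sq: "(\<integral>\<^sup>+z. ennreal ((cmod (\<beta> x z))\<^sup>2) \<partial>count_space B) = (\<integral>\<^sup>+z. f x z \<partial>count_space B)"
    if "x \<in> X" "B \<subseteq> X" for x B
    using that by (intro nn_integral_cong sq) auto
  have ell2: "\<beta> x \<in> ell2 X" if "x \<in> X" for x
    using that unfolding ell2_iff_nn_integral by (simp add: sum_sq one) (simp add: \<beta>_def)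
  have norm: "ell2_norm X (\<beta> x) = 1" if "x \<in> X" for x
  proof -
    have "ennreal ((ell2_norm X (\<beta> x))\<^sup>2) = 1"
      using that by (simp add: sum_sq one ell2 flip: nn_integral_ell2_norm)
    then have "(ell2_norm X (\<beta> x))\<^sup>2 = 1"
      by (simp add: ennreal_eq_1)
    then show ?thesis
      using ell2_norm_nonneg[of X "\<beta> x"] by (simp add: power2_eq_1_iff)
  qed
  have dist: "ell2_norm X (\<lambda>z. \<beta> x z - \<beta> y z) \<le> \<epsilon>" if x: "x \<in> X" and y: "y \<in> X" and "d x y \<le> R" for x y
  proof -
    obtain e where e: "\<And>z. z \<in> X \<Longrightarrow> f x z \<le> f y z + e z" "\<And>z. z \<in> X \<Longrightarrow> f y z \<le> f x z + e z"
      and e_le: "(\<integral>\<^sup>+z. e z \<partial>count_space X) \<le> ennreal (\<epsilon>\<^sup>2)"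
      using var[OF x y \<open>d x y \<le> R\<close>] by blast
    have "ennreal ((cmod (\<beta> x z - \<beta> y z))\<^sup>2) \<le> e z" if z: "z \<in> X" for z
    proof -
      have "cmod (\<beta> x z - \<beta> y z) = \<bar>sqrt (enn2real (f x z)) - sqrt (enn2real (f y z))\<bar>"
        using z by (simp add: \<beta>_def flip: of_real_diff)
      then have "ennreal ((cmod (\<beta> x z - \<beta> y z))\<^sup>2) \<le> ennreal \<bar>enn2real (f x z) - enn2real (f y z)\<bar>"
        by (simp add: ennreal_leI sqrt_diff_square_le)
      also have "\<dots> \<le> e z"
        using e z x y fin by (intro enn2real_diff_le) auto
      finally show ?thesis .
    qed
    then have "(\<integral>\<^sup>+z. ennreal ((cmod (\<beta> x z - \<beta> y z))\<^sup>2) \<partial>count_space X) \<le> (\<integral>\<^sup>+z. e z \<partial>count_space X)"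
      by (intro nn_integral_mono) auto
    also note e_le
    finally have "(ell2_norm X (\<lambda>z. \<beta> x z - \<beta> y z))\<^sup>2 \<le> \<epsilon>\<^sup>2"
      using x y by (simp add: nn_integral_ell2_norm ell2_diff ell2)
    then show ?thesis
      using \<open>0 < \<epsilon>\<close> by (simp add: power2_le_iff_abs_le)
  qed
  have "(SUP x\<in>X. (\<integral>\<^sup>+z. f x z \<partial>count_space (X - Metric_space.mball X d x S))) =
      (SUP x\<in>X. ennreal (\<Sum>\<^sub>\<infinity>w\<in>X - Metric_space.mball X d x S. (cmod (\<beta> x w))\<^sup>2))" for S
    by (intro SUP_cong refl) (simp add: ell2 sum_sq flip: nn_integral_ell2_subset[of _ X])
  with tail ell2 norm dist show "\<exists>\<beta>::'a \<Rightarrow> 'a \<Rightarrow> complex.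
        (\<forall>x\<in>X. \<beta> x \<in> ell2 X \<and> ell2_norm X (\<beta> x) = 1) \<and>
        (\<forall>x\<in>X. \<forall>y\<in>X. d x y \<le> R \<longrightarrow> ell2_norm X (\<lambda>w. \<beta> x w - \<beta> y w) \<le> \<epsilon>) \<and>
        ((\<lambda>S::real. SUP x\<in>X.
            ennreal (\<Sum>\<^sub>\<infinity>w\<in>X - Metric_space.mball X d x S. (cmod (\<beta> x w))\<^sup>2))
          \<longlongrightarrow> 0) at_top"
    by (intro exI[of _ \<beta>]) auto
qed

section \<open>The mixture of fibre densities\<close>

theorem corollary4p7:
  fixes X :: "'a set" and d :: "'a \<Rightarrow> 'a \<Rightarrow> real"
    and n :: nat and Y :: "nat \<Rightarrow> 'b set" and \<phi> :: "nat \<Rightarrow> 'a \<Rightarrow> 'b"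
  assumes "Metric_space X d"
    and "uniformly_discrete X d"
    and "bounded_geometry X d"
    and "\<forall>i\<in>{1..n}. \<phi> i \<in> X \<rightarrow> Y i"
    and "strongly_embeddable_maps X d n Y \<phi>"
    and "equi_strongly_embeddable (Sigma {1..n} Y) (\<lambda>(i, w). {x \<in> X. \<phi> i x = w}) (\<lambda>_. d)"
  shows "strongly_embeddable X d"
proof (rule strongly_embeddable_if_densities)
  interpret Metric_space X d by fact
  fix R \<epsilon> :: real
  assume "0 < R" "0 < \<epsilon>"
  \<comment> \<open>Error budget: 5\<delta> for the variation of the truncated densities, 3\<delta>
    for the variation inside the fibres, and \<delta> for the displaced mass at each of the two
    points.\<close>
  define \<delta> where "\<delta> = \<epsilon> / 10"
  have "0 < \<delta>" using \<open>0 < \<epsilon>\<close> by (simp add: \<delta>_def)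
  define D where "D = Sigma {1..n} Y"
  define F where "F = (\<lambda>(i, w). {x \<in> X. \<phi> i x = w})"
  define U where "U x S = (\<Union>i\<in>{1..n}. (\<lambda>y. (i, \<phi> i y)) ` mball x S)" for x S

  \<comment> \<open>Truncating the density on the disjoint union\<close>
  obtain \<xi> :: "'a \<Rightarrow> nat \<times> 'b \<Rightarrow> complex" where
    \<xi>: "\<And>x. x \<in> X \<Longrightarrow> \<xi> x \<in> ell2 D" "\<And>x. x \<in> X \<Longrightarrow> ell2_norm D (\<xi> x) = 1" and
    \<xi>_var: "\<And>x y. x \<in> X \<Longrightarrow> y \<in> X \<Longrightarrow> d x y \<le> R \<Longrightarrow> ell2_norm D (\<lambda>w. \<xi> x w - \<xi> y w) \<le> \<delta>" and
    \<xi>_lim: "((\<lambda>S. SUP x\<in>X. ennreal (\<Sum>\<^sub>\<infinity>w\<in>D - U x S. (cmod (\<xi> x w))\<^sup>2)) \<longlongrightarrow> 0) at_top"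
    using assms(5)[unfolded strongly_embeddable_maps_def, rule_format, OF \<open>0 < R\<close> \<open>0 < \<delta>\<close>]
    unfolding D_def[symmetric] U_def[symmetric] by (elim exE conjE) (rule that, auto)

  have "\<forall>\<^sub>F S in at_top. (SUP x\<in>X. ennreal (\<Sum>\<^sub>\<infinity>w\<in>D - U x S. (cmod (\<xi> x w))\<^sup>2)) < ennreal \<delta>"
    using \<xi>_lim \<open>0 < \<delta>\<close> by (intro order_tendstoD(2)) auto
  \<comment> \<open>The truncation radius is also taken positive, so that \<open>R + 2 * T\<close>
    is an admissible scale and every \<open>S > T\<close> is the radius of a ball containing its
    centre.\<close>
  then have "\<forall>\<^sub>F S in at_top. (0::real) < S \<and>
      (SUP x\<in>X. ennreal (\<Sum>\<^sub>\<infinity>w\<in>D - U x S. (cmod (\<xi> x w))\<^sup>2)) < ennreal \<delta>"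
    by (intro eventually_conj eventually_gt_at_top)
  then obtain T where "0 < T" and
    T: "(SUP x\<in>X. ennreal (\<Sum>\<^sub>\<infinity>w\<in>D - U x T. (cmod (\<xi> x w))\<^sup>2)) < ennreal \<delta>"
    using eventually_happens'[OF trivial_limit_at_top_linorder] by blast

  \<comment> \<open>The kept part is \<open>a\<close>, the removed part \<open>c\<close>, with total
    removed mass \<open>m x\<close>. From here on \<open>a x j \<noteq> 0\<close> certifies that the
    fibre of \<open>j\<close> meets the \<open>T\<close>-ball about \<open>x\<close>.\<close>
  define a where "a x j = (if j \<in> U x T then (cmod (\<xi> x j))\<^sup>2 else 0)" for x j
  define c where "c x j = (if j \<in> U x T then 0 else (cmod (\<xi> x j))\<^sup>2)" for x j
  define m where "m x = (\<integral>\<^sup>+j. ennreal (c x j) \<partial>count_space D)" for x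
  have ac: "0 \<le> a x j" "0 \<le> c x j" "a x j + c x j = (cmod (\<xi> x j))\<^sup>2" for x j
    by (auto simp: a_def c_def)
  have mass: "(\<integral>\<^sup>+j. ennreal (a x j) \<partial>count_space D) + m x = 1" if "x \<in> X" for x
  proof -
    have "(\<integral>\<^sup>+j. ennreal (a x j) \<partial>count_space D) + m x =
        (\<integral>\<^sup>+j. ennreal ((cmod (\<xi> x j))\<^sup>2) \<partial>count_space D)"
      unfolding m_def
      by (subst nn_integral_add[symmetric]) (auto simp: ac simp flip: ennreal_plus)
    then show ?thesis
      using that by (simp add: nn_integral_ell2_norm \<xi>)
  qed
  have m_le: "m x \<le> ennreal \<delta>" if "x \<in> X" for x
  proof -
    have "m x = (\<integral>\<^sup>+j. ennreal (c x j) \<partial>count_space (D - U x T))"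
      unfolding m_def by (intro nn_integral_count_space_eq) (auto simp: c_def)
    also have "\<dots> = (\<integral>\<^sup>+j. ennreal ((cmod (\<xi> x j))\<^sup>2) \<partial>count_space (D - U x T))"
      by (intro nn_integral_cong) (auto simp: c_def)
    also have "\<dots> = ennreal (\<Sum>\<^sub>\<infinity>w\<in>D - U x T. (cmod (\<xi> x w))\<^sup>2)"
      using that \<xi> by (intro nn_integral_ell2_subset) auto
    also have "\<dots> \<le> (SUP x\<in>X. ennreal (\<Sum>\<^sub>\<infinity>w\<in>D - U x T. (cmod (\<xi> x w))\<^sup>2))"
      using that by (intro SUP_upper)
    finally show ?thesis using T by order
  qed
  have a_var: "(\<integral>\<^sup>+j. ennreal \<bar>a x j - a y j\<bar> \<partial>count_space D) \<le> ennreal (5 * \<delta>)"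
    if "x \<in> X" "y \<in> X" "d x y \<le> R" for x y
  proof -
    \<comment> \<open>The truncation sets of \<open>x\<close> and \<open>y\<close> differ, so both
      removed parts enter: the full densities cost 3\<delta> and each removed part at most
      \<delta>.\<close>
    have "\<bar>a x j - a y j\<bar> \<le> \<bar>(cmod (\<xi> x j))\<^sup>2 - (cmod (\<xi> y j))\<^sup>2\<bar> + c x j + c y j" for j
      using ac[of x j] ac[of y j] by linarith
    then have "(\<integral>\<^sup>+j. ennreal \<bar>a x j - a y j\<bar> \<partial>count_space D) \<le>
        (\<integral>\<^sup>+j. ennreal \<bar>(cmod (\<xi> x j))\<^sup>2 - (cmod (\<xi> y j))\<^sup>2\<bar> + ennreal (c x j) + ennreal (c y j)
          \<partial>count_space D)"
      by (intro nn_integral_mono) (simp add: ac ennreal_leI flip: ennreal_plus)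
    also have "\<dots> = (\<integral>\<^sup>+j. ennreal \<bar>(cmod (\<xi> x j))\<^sup>2 - (cmod (\<xi> y j))\<^sup>2\<bar> \<partial>count_space D) + m x + m y"
      by (simp add: nn_integral_add m_def)
    also have "\<dots> \<le> ennreal (3 * \<delta>) + ennreal \<delta> + ennreal \<delta>"
      using that \<xi> \<xi>_var \<open>0 < \<delta>\<close> by (intro add_mono m_le ell2_unit_square_diff) auto
    also have "\<dots> = ennreal (5 * \<delta>)"
      using \<open>0 < \<delta>\<close> by (simp flip: ennreal_plus)
    finally show ?thesis .
  qed

  \<comment> \<open>Fibre densities and the mixture\<close>
  have "0 < R + 2 * T" using \<open>0 < R\<close> \<open>0 < T\<close> by simp
  obtain \<eta> :: "nat \<times> 'b \<Rightarrow> 'a \<Rightarrow> 'a \<Rightarrow> complex" where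
    \<eta>: "\<And>j p. j \<in> D \<Longrightarrow> p \<in> F j \<Longrightarrow> \<eta> j p \<in> ell2 (F j)"
      "\<And>j p. j \<in> D \<Longrightarrow> p \<in> F j \<Longrightarrow> ell2_norm (F j) (\<eta> j p) = 1" and
    \<eta>_var: "\<And>j p q. j \<in> D \<Longrightarrow> p \<in> F j \<Longrightarrow> q \<in> F j \<Longrightarrow> d p q \<le> R + 2 * T \<Longrightarrow>
        ell2_norm (F j) (\<lambda>w. \<eta> j p w - \<eta> j q w) \<le> \<delta>" and
    \<eta>_lim: "((\<lambda>S. SUP j\<in>D. SUP p\<in>F j.
        ennreal (\<Sum>\<^sub>\<infinity>w\<in>F j - Metric_space.mball (F j) d p S. (cmod (\<eta> j p w))\<^sup>2)) \<longlongrightarrow> 0) at_top"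
    using assms(6)[unfolded equi_strongly_embeddable_def, rule_format, OF \<open>0 < R + 2 * T\<close> \<open>0 < \<delta>\<close>]
    unfolding D_def[symmetric] F_def[symmetric] by (elim exE conjE) (rule that, auto)
  have F_sub: "F j \<subseteq> X" for j
    by (auto simp: F_def split: prod.splits)

  \<comment> \<open>Where the fibre misses the ball this choice is arbitrary. The facts about
    \<open>p\<close> and \<open>q\<close> therefore assume \<open>a x j \<noteq> 0\<close>;
    elsewhere the weight 0 removes the term.\<close>
  define p where "p x j = (SOME p. p \<in> F j \<and> p \<in> mball x T)" for x j
  define q where "q x j z = (cmod (\<eta> j (p x j) z))\<^sup>2" for x j z
  have p: "p x j \<in> F j" "d x (p x j) < T" if "a x j \<noteq> 0" for x j
  proof -
    have "\<exists>p. p \<in> F j \<and> p \<in> mball x T"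
      using that by (auto simp: a_def U_def F_def split: if_splits)
    then have "p x j \<in> F j \<and> p x j \<in> mball x T"
      unfolding p_def by (rule someI_ex)
    then show "p x j \<in> F j" "d x (p x j) < T" by auto
  qed
  have q_off: "q x j z = 0" if "j \<in> D" "a x j \<noteq> 0" "z \<notin> F j" for x j z
    using that \<eta>(1)[OF that(1) p(1)[OF that(2)]] by (auto simp: q_def ell2_def)
  have q_F: "(\<integral>\<^sup>+z. ennreal (q x j z) \<partial>count_space B) = (\<integral>\<^sup>+z. ennreal (q x j z) \<partial>count_space (B \<inter> F j))"
    if "j \<in> D" "a x j \<noteq> 0" for x j B
    using that q_off by (intro nn_integral_count_space_eq) auto
  have q_one: "(\<integral>\<^sup>+z. ennreal (q x j z) \<partial>count_space X) = 1" if "j \<in> D" "a x j \<noteq> 0" for x j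
    using that F_sub[of j] p(1)[OF that(2)]
    unfolding q_F[OF that, of X] by (simp add: Int_absorb1 q_def nn_integral_ell2_norm \<eta>)
  have q_var: "(\<integral>\<^sup>+z. ennreal \<bar>q x j z - q y j z\<bar> \<partial>count_space X) \<le> ennreal (3 * \<delta>)"
    if "j \<in> D" "a x j \<noteq> 0" "a y j \<noteq> 0" "x \<in> X" "y \<in> X" "d x y \<le> R" for x y j
  proof -
    have px: "p x j \<in> F j" "d x (p x j) < T" and py: "p y j \<in> F j" "d y (p y j) < T"
      using that p by auto
    then have "p x j \<in> X" "p y j \<in> X"
      using F_sub[of j] by auto
    then have "d (p x j) (p y j) \<le> d x (p x j) + d x y + d y (p y j)"
      using that triangle[of "p x j" x "p y j"] triangle[of x y "p y j"] commute[of x "p x j"] by simp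
    then have "d (p x j) (p y j) \<le> R + 2 * T"
      using px py that by simp
    then have "(\<integral>\<^sup>+z. ennreal \<bar>q x j z - q y j z\<bar> \<partial>count_space (F j)) \<le> ennreal (3 * \<delta>)"
      unfolding q_def using that(1) px py \<eta> \<eta>_var \<open>0 < \<delta>\<close>
      by (intro ell2_unit_square_diff) auto
    moreover have "(\<integral>\<^sup>+z. ennreal \<bar>q x j z - q y j z\<bar> \<partial>count_space X) =
        (\<integral>\<^sup>+z. ennreal \<bar>q x j z - q y j z\<bar> \<partial>count_space (F j))"
      using that F_sub[of j] q_off by (intro nn_integral_count_space_eq) auto
    ultimately show ?thesis by simp
  qed

  \<comment> \<open>The mass lost by truncation is placed at the base point, so that no normalisation is needed.\<close>
  define f where "f x z = (\<integral>\<^sup>+j. ennreal (a x j * q x j z) \<partial>count_space D) + m x * indicator {x} z" for x z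
  \<comment> \<open>By Tonelli, the mass of \<open>f x\<close> on \<open>B\<close> is an average of
    fibre masses plus the point mass. It is used with \<open>B = X\<close> for normalisation and
    with the complement of a ball for the tails.\<close>
  have f_sum: "(\<integral>\<^sup>+z. f x z \<partial>count_space B) =
      (\<integral>\<^sup>+j. ennreal (a x j) * (\<integral>\<^sup>+z. ennreal (q x j z) \<partial>count_space B) \<partial>count_space D) +
      m x * (\<integral>\<^sup>+z. indicator {x} z \<partial>count_space B)" for x B
    unfolding f_def
    by (simp add: nn_integral_add nn_integral_cmult ac q_def ennreal_mult
        nn_integral_count_space_swap[where A = D and B = B, symmetric])
  have point: "(\<integral>\<^sup>+z. indicator {x} z \<partial>count_space B) = (indicator B x :: ennreal)" for x :: 'a and B
    by (cases "x \<in> B") (auto simp: nn_integral_count_space'[of "{x}"] nn_integral_0_iff_AE AE_count_space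
        split: split_indicator)

  \<comment> \<open>Total mass, variation and tails of the mixture\<close>
  define t where "t S = (SUP j\<in>D. SUP p\<in>F j.
        ennreal (\<Sum>\<^sub>\<infinity>w\<in>F j - Metric_space.mball (F j) d p S. (cmod (\<eta> j p w))\<^sup>2))" for S
  show "\<exists>f :: 'a \<Rightarrow> 'a \<Rightarrow> ennreal.
      (\<forall>x\<in>X. (\<integral>\<^sup>+z. f x z \<partial>count_space X) = 1) \<and>
      (\<forall>x\<in>X. \<forall>y\<in>X. d x y \<le> R \<longrightarrow> (\<exists>e. (\<forall>z\<in>X. f x z \<le> f y z + e z \<and> f y z \<le> f x z + e z) \<and>
          (\<integral>\<^sup>+z. e z \<partial>count_space X) \<le> ennreal \<epsilon>)) \<and>
      ((\<lambda>S. SUP x\<in>X. (\<integral>\<^sup>+z. f x z \<partial>count_space (X - mball x S))) \<longlongrightarrow> 0) at_top"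
  proof (intro exI[of _ f] conjI ballI impI)
    fix x assume "x \<in> X"
    have "(\<integral>\<^sup>+j. ennreal (a x j) * (\<integral>\<^sup>+z. ennreal (q x j z) \<partial>count_space X) \<partial>count_space D) =
        (\<integral>\<^sup>+j. ennreal (a x j) \<partial>count_space D)"
    proof (intro nn_integral_cong)
      fix j assume "j \<in> space (count_space D)"
      then show "ennreal (a x j) * (\<integral>\<^sup>+z. ennreal (q x j z) \<partial>count_space X) = ennreal (a x j)"
        by (cases "a x j = 0") (auto simp: q_one)
    qed
    then show "(\<integral>\<^sup>+z. f x z \<partial>count_space X) = 1"
      using \<open>x \<in> X\<close> by (simp add: f_sum point mass)
  next
    fix x y assume xy: "x \<in> X" "y \<in> X" "d x y \<le> R"
    \<comment> \<open>The displaced masses sit at different points, so both are charged in full. The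
      majorant is symmetric in \<open>x\<close> and \<open>y\<close>, hence one estimate
      \<open>le\<close> yields both inequalities.\<close>
    define e where "e z = (\<integral>\<^sup>+j. ennreal \<bar>a x j * q x j z - a y j * q y j z\<bar> \<partial>count_space D) +
        m x * indicator {x} z + m y * indicator {y} z" for z
    have le: "f u z \<le> f v z + ((\<integral>\<^sup>+j. ennreal \<bar>a u j * q u j z - a v j * q v j z\<bar> \<partial>count_space D) +
        m u * indicator {u} z + m v * indicator {v} z)" for u v z
    proof -
      have "(\<integral>\<^sup>+j. ennreal (a u j * q u j z) \<partial>count_space D) \<le>
          (\<integral>\<^sup>+j. ennreal (a v j * q v j z) + ennreal \<bar>a u j * q u j z - a v j * q v j z\<bar> \<partial>count_space D)"
        by (intro nn_integral_mono) (simp add: ac q_def ennreal_leI flip: ennreal_plus)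
      also have "\<dots> = (\<integral>\<^sup>+j. ennreal (a v j * q v j z) \<partial>count_space D) +
          (\<integral>\<^sup>+j. ennreal \<bar>a u j * q u j z - a v j * q v j z\<bar> \<partial>count_space D)"
        by (simp add: nn_integral_add)
      finally have "f u z \<le> (\<integral>\<^sup>+j. ennreal (a v j * q v j z) \<partial>count_space D) +
          (\<integral>\<^sup>+j. ennreal \<bar>a u j * q u j z - a v j * q v j z\<bar> \<partial>count_space D) + m u * indicator {u} z"
        unfolding f_def by (intro add_right_mono)
      \<comment> \<open>One copy completes \<open>f v z\<close>; the other makes the error term
        symmetric.\<close>
      also have "\<dots> \<le> \<dots> + (m v * indicator {v} z + m v * indicator {v} z)"
        by simp
      finally show ?thesis
        by (simp add: f_def ac_simps)
    qed
    have "(\<integral>\<^sup>+z. e z \<partial>count_space X) =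
        (\<integral>\<^sup>+j. (\<integral>\<^sup>+z. ennreal \<bar>a x j * q x j z - a y j * q y j z\<bar> \<partial>count_space X) \<partial>count_space D) + m x + m y"
      unfolding e_def using xy
      by (simp add: nn_integral_add nn_integral_cmult point nn_integral_count_space_swap[where A = D and B = X, symmetric])
    \<comment> \<open>For each \<open>j\<close>, changing the weight costs
      \<open>\<bar>a x j - a y j\<bar>\<close> and changing the fibre density costs 3\<delta> times
      \<open>a y j\<close>. The weights of \<open>y\<close> sum to at most 1.\<close>
    also have "\<dots> \<le> (\<integral>\<^sup>+j. ennreal \<bar>a x j - a y j\<bar> + ennreal (a y j) * ennreal (3 * \<delta>) \<partial>count_space D) +
        ennreal \<delta> + ennreal \<delta>"
      using xy
      by (intro add_mono nn_integral_mono nn_integral_weighted_diff_le m_le q_one q_var)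
        (auto simp: ac q_def)
    also have "(\<integral>\<^sup>+j. ennreal \<bar>a x j - a y j\<bar> + ennreal (a y j) * ennreal (3 * \<delta>) \<partial>count_space D) =
        (\<integral>\<^sup>+j. ennreal \<bar>a x j - a y j\<bar> \<partial>count_space D) +
        (\<integral>\<^sup>+j. ennreal (a y j) \<partial>count_space D) * ennreal (3 * \<delta>)"
      by (simp add: nn_integral_add nn_integral_multc)
    also have "\<dots> \<le> ennreal (5 * \<delta>) + 1 * ennreal (3 * \<delta>)"
      using xy mass[OF xy(2)] by (intro add_mono a_var mult_right_mono) (auto simp: le_iff_add)
    finally have "(\<integral>\<^sup>+z. e z \<partial>count_space X) \<le> ennreal (5 * \<delta>) + 1 * ennreal (3 * \<delta>) + ennreal \<delta> + ennreal \<delta>"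
      by (simp add: add_right_mono)
    also have "\<dots> = ennreal \<epsilon>"
      using \<open>0 < \<epsilon>\<close> by (simp add: \<delta>_def flip: ennreal_plus)
    finally show "\<exists>e. (\<forall>z\<in>X. f x z \<le> f y z + e z \<and> f y z \<le> f x z + e z) \<and>
        (\<integral>\<^sup>+z. e z \<partial>count_space X) \<le> ennreal \<epsilon>"
      using le[of x _ y] le[of y _ x]
      by (intro exI[of _ e]) (simp add: e_def abs_minus_commute ac_simps)
  next
    \<comment> \<open>Since \<open>p x j\<close> is within \<open>T\<close> of \<open>x\<close>,
      fibre points outside the \<open>S\<close>-ball about \<open>x\<close> lie outside the ball of
      radius \<open>S - T\<close> about \<open>p x j\<close>, and \<open>t\<close> bounds these
      fibre tails uniformly in \<open>j\<close>. The mass \<open>m x\<close> sits at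
      \<open>x\<close>, inside the ball because \<open>S > T > 0\<close>.\<close>
    have tail: "(\<integral>\<^sup>+z. f x z \<partial>count_space (X - mball x S)) \<le> t (S - T)" if "x \<in> X" "T < S" for x S
    proof -
      have "ennreal (a x j) * (\<integral>\<^sup>+z. ennreal (q x j z) \<partial>count_space (X - mball x S)) \<le>
          ennreal (a x j) * t (S - T)" if j: "j \<in> D" for j
      proof (cases "a x j = 0")
        case False
        note pj = p[OF False]
        interpret F: Metric_space "F j" d by (rule subspace) (rule F_sub)
        have "(X - mball x S) \<inter> F j \<subseteq> F j - F.mball (p x j) (S - T)"
        proof safe
          fix z assume z: "z \<in> X" "z \<notin> mball x S" "z \<in> F.mball (p x j) (S - T)"
          have "p x j \<in> X" using pj F_sub[of j] by auto
          then have "d x z \<le> d x (p x j) + d (p x j) z"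
            using z \<open>x \<in> X\<close> triangle by blast
          then show False
            using z pj \<open>x \<in> X\<close> by auto
        qed
        then have "(\<integral>\<^sup>+z. ennreal (q x j z) \<partial>count_space (X - mball x S)) \<le>
            (\<integral>\<^sup>+z. ennreal (q x j z) \<partial>count_space (F j - F.mball (p x j) (S - T)))"
          unfolding q_F[OF j False, of "X - mball x S"] by (rule nn_integral_count_space_subset_le)
        also have "\<dots> = ennreal (\<Sum>\<^sub>\<infinity>w\<in>F j - F.mball (p x j) (S - T). (cmod (\<eta> j (p x j) w))\<^sup>2)"
          unfolding q_def using j pj by (intro nn_integral_ell2_subset[OF \<eta>(1)]) auto
        also have "\<dots> \<le> t (S - T)"
          unfolding t_def using j pj by (intro SUP_upper2[of j] SUP_upper2[of "p x j"]) auto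
        finally show ?thesis by (intro mult_left_mono) auto
      qed simp
      then have "(\<integral>\<^sup>+z. f x z \<partial>count_space (X - mball x S)) \<le>
          (\<integral>\<^sup>+j. ennreal (a x j) * t (S - T) \<partial>count_space D)"
        unfolding f_sum using that \<open>0 < T\<close> by (auto simp: point intro!: nn_integral_mono)
      also have "\<dots> = (\<integral>\<^sup>+j. ennreal (a x j) \<partial>count_space D) * t (S - T)"
        by (simp add: nn_integral_multc)
      also have "\<dots> \<le> 1 * t (S - T)"
        using mass[OF \<open>x \<in> X\<close>] by (intro mult_right_mono) (auto simp: le_iff_add)
      finally show ?thesis by simp
    qed
    have "((\<lambda>S. t (S - T)) \<longlongrightarrow> 0) at_top"
    proof (rule filterlim_compose[of t])
      show "(t \<longlongrightarrow> 0) at_top"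
        using \<eta>_lim by (simp add: t_def[abs_def])
      show "LIM S at_top. S - T :> at_top"
        using filterlim_tendsto_add_at_top[OF tendsto_const[of "- T"] filterlim_ident] by simp
    qed
    moreover have "\<forall>\<^sub>F S in at_top. (SUP x\<in>X. (\<integral>\<^sup>+z. f x z \<partial>count_space (X - mball x S))) \<le> t (S - T)"
      using eventually_gt_at_top[of T] by eventually_elim (auto intro!: SUP_least tail)
    ultimately show "((\<lambda>S. SUP x\<in>X. (\<integral>\<^sup>+z. f x z \<partial>count_space (X - mball x S))) \<longlongrightarrow> 0) at_top"
      using tendsto_sandwich[where f = "\<lambda>_. 0" and h = "\<lambda>S. t (S - T)", OF _ _ tendsto_const]
      by fastforce
  qed
qed

end
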